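(* For every constant deletion probability $p\in(0,1)$ there is a constant $C>0$ (depending only on $p$) such that for every $n\ge2$ and any two distinct strings $\mathbf{x},\mathbf{y}\in\{0,1\}^n$ with edit distance $d_{\mathsf{E}}(\mathbf{x},\mathbf{y})=2$, there is a mean-based algorithm that distinguishes between $\mathbf{x}$ and $\mathbf{y}$ with high probability using at most $n^{C}$ traces.
   Context: Strings are indexed from $0$: $\mathbf{x}=x_0x_1\cdots x_{n-1}$. The edit distance $d_{\mathsf{E}}$ is the minimum number of insertions and deletions (of single bits) that transform one string into the other. A trace $\tilde{\mathbf{x}}$ of $\mathbf{x}$ is the random subsequence of $\mathbf{x}$ obtained by deleting each bit independently with probability $p$; it is padded by setting $\tilde x_j=0$ for all $j\ge|\tilde{\mathbf{x}}|$. A mean-based algorithm using $T$ traces for distinguishing $\mathbf{x}$ and $\mathbf{y}$ (which are known to the algorithm) receives $T$ independent traces $\tilde{\mathbf{x}}^{(1)},\dots,\tilde{\mathbf{x}}^{(T)}$ of an unknown source string in $\{\mathbf{x},\mathbf{y}\}$, and its output (either "$\mathbf{x}$" or "$\mathbf{y}$") depends only on the empirical means $\hat E_j=\frac1T\sum_{t=1}^T \tilde x^{(t)}_j$, $j=0,\dots,n-1$. It distinguishes with high probability if, whichever of $\mathbf{x},\mathbf{y}$ is the source, it outputs the source with probability at least $2/3$. *)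

theory Defs
  imports "HOL-Probability.Probability" "HOL-Library.More_List"
begin

text \<open>Bit strings are lists over \<^typ>\<open>bool\<close>, with \<^const>\<open>True\<close> standing for the bit 1.\<close>

definition insertion :: "'a list \<Rightarrow> 'a list \<Rightarrow> bool" where
  "insertion s t \<longleftrightarrow> (\<exists>u b v. s = u @ v \<and> t = u @ [b] @ v)"

definition single_edit :: "'a list \<Rightarrow> 'a list \<Rightarrow> bool" where
  "single_edit s t \<longleftrightarrow> insertion s t \<or> insertion t s"

text \<open>Any two strings are connected by single edits (through the empty string), so the minimum
  below is always attained. Substitutions are not an elementary edit.\<close>

definition edit_dist :: "'a list \<Rightarrow> 'a list \<Rightarrow> nat" where
  "edit_dist s t = (LEAST k. (single_edit ^^ k) s t)"

text \<open>The random list \<open>del\<close> marks the deleted positions.\<close>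

definition trace_pmf :: "real \<Rightarrow> bool list \<Rightarrow> bool list pmf" where
  "trace_pmf p x =
     map_pmf (\<lambda>del. map fst (filter (\<lambda>(b, d). \<not> d) (zip x del)))
       (replicate_pmf (length x) (bernoulli_pmf p))"

text \<open>The value \<^term>\<open>nth_default False t j\<close> is bit \<open>j\<close> of the trace \<open>t\<close> padded with zeros.\<close>

definition empirical_means :: "nat \<Rightarrow> bool list list \<Rightarrow> real list" where
  "empirical_means n ts =
     map (\<lambda>j. (\<Sum>t\<leftarrow>ts. of_bool (nth_default False t j)) / real (length ts)) [0..<n]"

text \<open>A mean-based algorithm for \<open>x\<close> and \<open>y\<close> is represented by the map \<open>A\<close> from the vector of
  empirical means to the output string. For \<open>T = 0\<close> the means are 0 by the convention for division
  by zero; the output is then constant, so distinct strings cannot be distinguished.\<close>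

definition distinguishes_whp ::
    "real \<Rightarrow> nat \<Rightarrow> nat \<Rightarrow> bool list \<Rightarrow> bool list \<Rightarrow> (real list \<Rightarrow> bool list) \<Rightarrow> bool" where
  "distinguishes_whp p n T x y A \<longleftrightarrow>
     range A \<subseteq> {x, y} \<and>
     (\<forall>s\<in>{x, y}.
        measure_pmf.prob (replicate_pmf T (trace_pmf p s))
          {ts. A (empirical_means n ts) = s} \<ge> 2 / 3)"

end

theory Submission
  imports Defs
begin

text \<open>Let \<open>W(x)\<close> be the number of ones of \<open>x\<close> and \<open>G(x)\<close> the sum of the positions of its ones. For a
  trace \<open>t\<close> of \<open>x\<close> the expectations of \<open>W(t)\<close> and \<open>G(t)\<close> are \<open>(1 - p) W(x)\<close> and
  \<open>(1 - p)\<^sup>2 G(x)\<close>, and both \<open>W\<close> and \<open>G\<close> are linear in the bits, so they can be estimated from the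
  empirical means. Two distinct strings of equal length at edit distance 2 are, up to order, of the form
  \<open>u b s v\<close> and \<open>u s c v\<close>. Equality of \<open>W\<close> forces \<open>b = c\<close>, and then equality of \<open>G\<close> forces \<open>s\<close> to
  be a power of \<open>b\<close>, so that the strings coincide. Hence \<open>W\<close> or \<open>G\<close> separates the two means by at
  least \<open>(1 - p)\<^sup>2\<close>, while the statistic is at most \<open>n\<^sup>2\<close>, and Chebyshev's inequality applies.\<close>

subsection \<open>Strings at edit distance 2\<close>

primrec ones :: "bool list \<Rightarrow> nat" where
  "ones [] = 0"
| "ones (b # x) = of_bool b + ones x"

text \<open>Positions count from 0: the head contributes nothing, and prepending it moves each one
  of \<open>x\<close> one place to the right, which adds \<open>ones x\<close>.\<close>

primrec ones_pos_sum :: "bool list \<Rightarrow> nat" where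
  "ones_pos_sum [] = 0"
| "ones_pos_sum (b # x) = ones_pos_sum x + ones x"

lemma ones_append: "ones (x @ y) = ones x + ones y"
  by (induction x) auto

lemma ones_pos_sum_append:
  "ones_pos_sum (x @ y) = ones_pos_sum x + ones_pos_sum y + length x * ones y"
  by (induction x) (auto simp: ones_append)

lemma ones_le_length: "ones x \<le> length x"
  by (induction x) (auto intro: le_SucI)

lemma ones_eq_0D: "ones x = 0 \<Longrightarrow> x = replicate (length x) False"
  by (induction x) auto

lemma ones_eq_lengthD: "ones x = length x \<Longrightarrow> x = replicate (length x) True"
proof (induction x)
  case (Cons b x)
  then show ?case
    using ones_le_length[of x] by (cases b) auto
qed simp

lemma moved_bit_eq_of_moments_eq:
  assumes W: "ones (u @ b # s @ v) = ones (u @ s @ c # v)"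
    and G: "ones_pos_sum (u @ b # s @ v) = ones_pos_sum (u @ s @ c # v)"
  shows "u @ b # s @ v = u @ s @ c # v"
proof -
  have bc: "b = c"
    using W by (cases b; cases c) (auto simp: ones_append)
  \<comment> \<open>Moving \<open>b\<close> to the right across \<open>s\<close> shifts each one in
    \<open>s\<close> one place left and \<open>b\<close> itself \<open>length s\<close> places
    right; equal position sums make the two effects cancel.\<close>
  have "ones s = length s * of_bool b"
    using G bc by (cases b) (auto simp: ones_append ones_pos_sum_append algebra_simps)
  then obtain k where "s = replicate k b"
    using ones_eq_0D[of s] ones_eq_lengthD[of s] by (cases b) auto
  \<comment> \<open>A block of copies of \<open>b\<close> commutes with \<open>b\<close>, so the
    move changes nothing.\<close>
  then have "s @ [b] = b # s"
    by (simp add: replicate_append_same)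
  then have "(s @ [b]) @ v = (b # s) @ v"
    by (rule arg_cong)
  then show ?thesis
    using bc by simp
qed

section \<open>Edit distance 2 as moving one bit\<close>

lemma single_edit_sym: "single_edit s t \<Longrightarrow> single_edit t s"
  by (auto simp: single_edit_def)

lemma single_edit_Cons: "single_edit s (b # s)"
  unfolding single_edit_def insertion_def by (metis append_Nil append_Cons)

lemma single_edit_connected: "single_edit\<^sup>*\<^sup>* s t"
proof -
  have from_Nil: "single_edit\<^sup>*\<^sup>* [] r" for r :: "'a list"
    by (induction r) (auto intro: rtranclp.rtrancl_into_rtrancl single_edit_Cons)
  have "single_edit\<^sup>*\<^sup>* r []" for r :: "'a list"
    by (induction r)
      (auto intro: converse_rtranclp_into_rtranclp single_edit_sym single_edit_Cons)
  then show ?thesis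
    using from_Nil by (meson rtranclp_trans)
qed

text \<open>Connectedness makes the set under \<open>LEAST\<close> nonempty, so the minimum is
  attained by an actual chain of edits.\<close>

lemma relpowp_edit_dist: "(single_edit ^^ edit_dist s t) s t"
proof -
  obtain k where "(single_edit ^^ k) s t"
    using single_edit_connected[of s t] by (meson rtranclp_imp_relpowp)
  then show ?thesis
    unfolding edit_dist_def by (rule LeastI)
qed

lemma length_insertion: "insertion s t \<Longrightarrow> length t = Suc (length s)"
  by (auto simp: insertion_def)

lemma insertion_insertion_length_neq:
  "insertion s z \<Longrightarrow> insertion z t \<Longrightarrow> length s \<noteq> length t"
  using length_insertion[of s z] length_insertion[of z t] by simp

text \<open>The moved bit may change its value, and it only moves to the right; leftward moves are
  covered by exchanging \<open>x\<close> and \<open>y\<close>.\<close>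

definition bit_moved :: "'a list \<Rightarrow> 'a list \<Rightarrow> bool" where
  "bit_moved x y \<longleftrightarrow> (\<exists>u b s c v. x = u @ b # s @ v \<and> y = u @ s @ c # v)"

text \<open>The stretch of \<open>z\<close> between the two insertion points is the \<open>s\<close>
  across which the bit moves; the order of the points decides which disjunct holds.\<close>

lemma common_subsequence_bit_moved:
  assumes "insertion z x" and "insertion z y"
  shows "bit_moved x y \<or> bit_moved y x"
proof -
  obtain u b v where x: "z = u @ v" "x = u @ b # v"
    using assms(1) by (auto simp: insertion_def)
  obtain u' c v' where y: "z = u' @ v'" "y = u' @ c # v'"
    using assms(2) by (auto simp: insertion_def)
  from x(1) y(1) have "u @ v = u' @ v'" by simp
  then consider s where "u' = u @ s" "v = s @ v'" | s where "u = u' @ s" "v' = s @ v"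
    by (auto simp: append_eq_append_conv2)
  then show ?thesis
  proof cases
    case (1 s)
    then have "x = u @ b # s @ v'" "y = u @ s @ c # v'" using x y by auto
    then show ?thesis unfolding bit_moved_def by blast
  next
    case (2 s)
    then have "y = u' @ c # s @ v" "x = u' @ s @ b # v" using x y by auto
    then show ?thesis unfolding bit_moved_def by blast
  qed
qed

text \<open>Each string lacks one position of \<open>z\<close> and keeps the one that the other
  lacks. A common position would give \<open>x = y\<close>.\<close>

lemma common_supersequence_bit_moved:
  assumes "insertion x z" and "insertion y z" and "x \<noteq> y"
  shows "bit_moved x y \<or> bit_moved y x"
proof -
  obtain u b v where x: "x = u @ v" "z = u @ b # v"
    using assms(1) by (auto simp: insertion_def)
  obtain u' c v' where y: "y = u' @ v'" "z = u' @ c # v'"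
    using assms(2) by (auto simp: insertion_def)
  from x(2) y(2) have "u @ b # v = u' @ c # v'" by simp
  then consider "u = u'" "v = v'" | s where "u' = u @ b # s" "v = s @ c # v'"
    | s where "u = u' @ c # s" "v' = s @ b # v"
    by (auto simp: append_eq_append_conv2 Cons_eq_append_conv append_eq_Cons_conv)
  then show ?thesis
  proof cases
    case 1
    then show ?thesis using x y assms(3) by simp
  next
    case (2 s)
    then have "y = u @ b # s @ v'" "x = u @ s @ c # v'" using x y by auto
    then show ?thesis unfolding bit_moved_def by blast
  next
    case (3 s)
    then have "x = u' @ c # s @ v" "y = u' @ s @ b # v" using x y by auto
    then show ?thesis unfolding bit_moved_def by blast
  qed
qed

lemma edit_dist_2_moments_differ:
  assumes len: "length x = length y" and ne: "x \<noteq> y" and ed: "edit_dist x y = 2"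
  shows "ones x \<noteq> ones y \<or> ones_pos_sum x \<noteq> ones_pos_sum y"
proof -
  have "(single_edit ^^ 2) x y"
    using relpowp_edit_dist[of x y] ed by simp
  then obtain z where "single_edit x z" "single_edit z y"
    by (auto simp: numeral_2_eq_2)
  \<comment> \<open>Equal lengths exclude two insertions or two deletions, so there is one of each,
    in either order.\<close>
  then consider "insertion z x" "insertion z y" | "insertion x z" "insertion y z"
    using len insertion_insertion_length_neq unfolding single_edit_def by metis
  then have "bit_moved x y \<or> bit_moved y x"
    using common_subsequence_bit_moved common_supersequence_bit_moved ne by cases blast+
  then show ?thesis
    using ne moved_bit_eq_of_moments_eq unfolding bit_moved_def by metis
qed

subsection \<open>Expected moments of a trace\<close>

lemma expectation_bind_pmf_finite:
  fixes h :: "'b \<Rightarrow> real"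
  assumes "finite (set_pmf M)" and "\<And>x. x \<in> set_pmf M \<Longrightarrow> finite (set_pmf (f x))"
  shows "measure_pmf.expectation (M \<bind> f) h =
    measure_pmf.expectation M (\<lambda>x. measure_pmf.expectation (f x) h)"
proof -
  have "measure_pmf.expectation M (\<lambda>x. measure_pmf.expectation (f x) h) =
      (\<Sum>x\<in>set_pmf M. pmf M x *\<^sub>R measure_pmf.expectation (f x) h)"
    by (rule integral_measure_pmf[OF assms(1)]) auto
  then show ?thesis
    using assms by (simp add: pmf_expectation_bind[of "set_pmf M"])
qed

lemma finite_set_replicate_pmf:
  assumes "finite (set_pmf M)"
  shows "finite (set_pmf (replicate_pmf n M))"
  using finite_lists_length_eq[OF assms, of n]
  by (simp add: set_replicate_pmf lists_eq_set Collect_conj_eq conj_commute)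

lemma finite_set_trace_pmf: "finite (set_pmf (trace_pmf p x))"
  unfolding trace_pmf_def by (simp add: finite_set_replicate_pmf)

lemma trace_pmf_Nil: "trace_pmf p [] = return_pmf []"
  by (simp add: trace_pmf_def)

text \<open>Splitting off the coin of the first bit gives the recursion by which expectations over
  traces are computed.\<close>

lemma trace_pmf_Cons:
  "trace_pmf p (b # x) =
     bernoulli_pmf p \<bind> (\<lambda>d. map_pmf (\<lambda>t. if d then t else b # t) (trace_pmf p x))"
  by (simp add: trace_pmf_def map_bind_pmf map_pmf_def bind_assoc_pmf bind_return_pmf if_distrib
      cong: if_cong) (auto intro!: bind_pmf_cong simp: bind_return_pmf)

lemma length_trace_le: "t \<in> set_pmf (trace_pmf p x) \<Longrightarrow> length t \<le> length x"
  unfolding trace_pmf_def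
  by (auto simp: set_replicate_pmf intro!: order.trans[OF length_filter_le])

lemma integrable_trace_pmf: "integrable (measure_pmf (trace_pmf p x)) (f :: _ \<Rightarrow> real)"
  by (rule integrable_measure_pmf_finite[OF finite_set_trace_pmf])

lemma expectation_trace_pmf_Cons:
  fixes f :: "bool list \<Rightarrow> real"
  assumes "0 \<le> p" "p \<le> 1"
  shows "measure_pmf.expectation (trace_pmf p (b # x)) f =
    p * measure_pmf.expectation (trace_pmf p x) f +
    (1 - p) * measure_pmf.expectation (trace_pmf p x) (\<lambda>t. f (b # t))"
  using assms unfolding trace_pmf_Cons
  by (subst expectation_bind_pmf_finite) (auto simp: finite_set_trace_pmf)

lemma expectation_ones_trace:
  assumes "0 \<le> p" "p \<le> 1"
  shows "measure_pmf.expectation (trace_pmf p x) (\<lambda>t. real (ones t)) = (1 - p) * real (ones x)"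
proof (induction x)
  case (Cons b x)
  then show ?case
    using assms by (simp add: expectation_trace_pmf_Cons integrable_trace_pmf algebra_simps)
qed (simp add: trace_pmf_Nil)

text \<open>A one at position \<open>i\<close> survives with probability \<open>1 - p\<close>, and
  independently \<open>(1 - p) * i\<close> of its predecessors survive on average; hence the
  square.\<close>

lemma expectation_ones_pos_sum_trace:
  assumes "0 \<le> p" "p \<le> 1"
  shows "measure_pmf.expectation (trace_pmf p x) (\<lambda>t. real (ones_pos_sum t)) =
    (1 - p)\<^sup>2 * real (ones_pos_sum x)"
proof (induction x)
  case (Cons b x)
  then show ?case
    using assms
    by (simp add: expectation_trace_pmf_Cons expectation_ones_trace integrable_trace_pmf
        power2_eq_square algebra_simps)
qed (simp add: trace_pmf_Nil)

text \<open>The window \<open>n\<close> may exceed \<open>length t\<close>, since the padding is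
  zero. It varies in the induction because the tail is read in a window shorter by one.\<close>

lemma ones_eq_sum:
  "length t \<le> n \<Longrightarrow> (\<Sum>j<n. of_bool (nth_default False t j)) = real (ones t)"
proof (induction t arbitrary: n)
  case (Cons b t)
  then obtain m where "n = Suc m" "length t \<le> m" by (cases n) auto
  then show ?case
    using Cons.IH[of m]
    by (simp add: sum.lessThan_Suc_shift del: sum.lessThan_Suc sum_of_bool_eq)
qed simp

lemma ones_pos_sum_eq_sum:
  "length t \<le> n \<Longrightarrow>
    (\<Sum>j<n. real j * of_bool (nth_default False t j)) = real (ones_pos_sum t)"
proof (induction t arbitrary: n)
  case (Cons b t)
  then obtain m where "n = Suc m" "length t \<le> m" by (cases n) auto
  then show ?case
    using Cons.IH[of m] ones_eq_sum[of t m]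
    by (simp add: sum.lessThan_Suc_shift distrib_right sum.distrib
        del: sum.lessThan_Suc sum_of_bool_eq sum_mult_of_bool_eq)
qed simp

subsection \<open>Estimating a linear statistic from the empirical means\<close>

lemma expectation_replicate_pmf_Suc:
  fixes h :: "'a list \<Rightarrow> real"
  assumes "finite (set_pmf M)"
  shows "measure_pmf.expectation (replicate_pmf (Suc n) M) h =
    measure_pmf.expectation M
      (\<lambda>a. measure_pmf.expectation (replicate_pmf n M) (\<lambda>as. h (a # as)))"
  using assms
  by (simp add: expectation_bind_pmf_finite finite_set_replicate_pmf map_pmf_def[symmetric])

text \<open>By independence the cross terms of the square are products with a vanishing mean, so
  variances add up.\<close>

lemma expectation_centered_sum_list:
  fixes g :: "'a \<Rightarrow> real"
  assumes fin: "finite (set_pmf M)" and mean: "measure_pmf.expectation M g = 0"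
  shows "measure_pmf.expectation (replicate_pmf n M) (\<lambda>as. \<Sum>a\<leftarrow>as. g a) = 0"
    and "measure_pmf.expectation (replicate_pmf n M) (\<lambda>as. (\<Sum>a\<leftarrow>as. g a)\<^sup>2) =
      real n * measure_pmf.expectation M (\<lambda>a. (g a)\<^sup>2)"
proof -
  note int = integrable_measure_pmf_finite[OF fin]
    integrable_measure_pmf_finite[OF finite_set_replicate_pmf[OF fin]]
  show first: "measure_pmf.expectation (replicate_pmf n M) (\<lambda>as. \<Sum>a\<leftarrow>as. g a) = 0" for n
  proof (induction n)
    case (Suc n)
    then show ?case
      using fin mean by (simp add: expectation_replicate_pmf_Suc int del: replicate_pmf.simps)
  qed simp
  show "measure_pmf.expectation (replicate_pmf n M) (\<lambda>as. (\<Sum>a\<leftarrow>as. g a)\<^sup>2) =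
      real n * measure_pmf.expectation M (\<lambda>a. (g a)\<^sup>2)"
  proof (induction n)
    case (Suc n)
    then show ?case
      using fin mean first[of n]
      by (simp add: expectation_replicate_pmf_Suc int power2_sum algebra_simps
          del: replicate_pmf.simps)
  qed simp
qed

lemma Chebyshev_replicate_pmf:
  fixes f :: "'a \<Rightarrow> real"
  assumes fin: "finite (set_pmf M)" and bound: "\<And>a. a \<in> set_pmf M \<Longrightarrow> \<bar>f a\<bar> \<le> B"
    and "0 < \<epsilon>" "0 < T"
  shows "measure_pmf.prob (replicate_pmf T M)
      {as. \<epsilon> \<le> \<bar>(\<Sum>a\<leftarrow>as. f a) / real (length as) - measure_pmf.expectation M f\<bar>}
    \<le> B\<^sup>2 / (real T * \<epsilon>\<^sup>2)"
proof -
  define \<mu> where "\<mu> = measure_pmf.expectation M f"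
  define S where "S as = (\<Sum>a\<leftarrow>as. f a - \<mu>)" for as
  note int = integrable_measure_pmf_finite[OF fin]
  let ?R = "replicate_pmf T M"
  have "measure_pmf.expectation M (\<lambda>a. (f a - \<mu>)\<^sup>2) =
      measure_pmf.expectation M (\<lambda>a. (f a)\<^sup>2) - \<mu>\<^sup>2"
    by (simp add: power2_diff int \<mu>_def[symmetric] algebra_simps) (simp add: power2_eq_square)
  also have "\<dots> \<le> measure_pmf.expectation M (\<lambda>a. (f a)\<^sup>2)" by simp
  also have "\<dots> \<le> B\<^sup>2"
  proof (rule measure_pmf.integral_le_const[OF int])
    show "AE a in M. (f a)\<^sup>2 \<le> B\<^sup>2"
      using bound by (auto simp: AE_measure_pmf_iff intro: power2_le_iff_abs_le[THEN iffD2]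
          abs_le_square_iff[THEN iffD1] order.trans[OF _ abs_ge_self])
  qed
  finally have var: "measure_pmf.expectation M (\<lambda>a. (f a - \<mu>)\<^sup>2) \<le> B\<^sup>2" .
  have ES: "measure_pmf.expectation ?R (\<lambda>as. (S as)\<^sup>2) \<le> real T * B\<^sup>2"
    unfolding S_def using var
    by (subst expectation_centered_sum_list(2)[OF fin]) (auto simp: int \<mu>_def mult_left_mono)
  have S_eq: "S as = (\<Sum>a\<leftarrow>as. f a) - real (length as) * \<mu>" for as
    unfolding S_def by (induction as) (auto simp: algebra_simps)
  have "measure_pmf.prob ?R {as. \<epsilon> \<le> \<bar>(\<Sum>a\<leftarrow>as. f a) / real (length as) - \<mu>\<bar>}
      \<le> measure_pmf.prob ?R {as \<in> space (measure_pmf ?R). (real T * \<epsilon>)\<^sup>2 \<le> (S as)\<^sup>2}"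
  \<comment> \<open>The inclusion is only almost sure: \<open>length as = T\<close> holds on the
    support, not for arbitrary lists.\<close>
  proof (rule measure_pmf.finite_measure_mono_AE)
    have "(real T * \<epsilon>)\<^sup>2 \<le> (S as)\<^sup>2"
      if "length as = T" "\<epsilon> \<le> \<bar>(\<Sum>a\<leftarrow>as. f a) / real (length as) - \<mu>\<bar>" for as
    proof -
      have "S as = real T * ((\<Sum>a\<leftarrow>as. f a) / real (length as) - \<mu>)"
        using that(1) \<open>0 < T\<close> by (simp add: S_eq field_simps)
      then have "real T * \<epsilon> \<le> \<bar>S as\<bar>"
        using that(2) by (simp add: abs_mult mult_left_mono)
      then have "\<bar>real T * \<epsilon>\<bar> \<le> \<bar>S as\<bar>"
        using \<open>0 < \<epsilon>\<close> by simp
      then show ?thesis by (simp only: abs_le_square_iff)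
    qed
    then show "AE as in ?R. as \<in> {as. \<epsilon> \<le> \<bar>(\<Sum>a\<leftarrow>as. f a) / real (length as) - \<mu>\<bar>} \<longrightarrow>
        as \<in> {as \<in> space (measure_pmf ?R). (real T * \<epsilon>)\<^sup>2 \<le> (S as)\<^sup>2}"
      by (auto simp: AE_measure_pmf_iff set_replicate_pmf)
  qed simp
  \<comment> \<open>Markov's inequality for the square of \<open>S\<close>.\<close>
  also have "\<dots> \<le> measure_pmf.expectation ?R (\<lambda>as. (S as)\<^sup>2) / (real T * \<epsilon>)\<^sup>2"
    using assms(3,4)
    by (intro integral_Markov_inequality_measure[where A = "{}"]
        integrable_measure_pmf_finite finite_set_replicate_pmf fin) auto
  also have "\<dots> \<le> real T * B\<^sup>2 / (real T * \<epsilon>)\<^sup>2"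
    by (intro divide_right_mono ES) simp
  also have "\<dots> = B\<^sup>2 / (real T * \<epsilon>\<^sup>2)"
    using \<open>0 < T\<close> by (simp add: power_mult_distrib power2_eq_square)
  finally show ?thesis by (simp add: \<mu>_def)
qed

section \<open>Nearest-mean test for a linear statistic\<close>

definition linear_stat :: "nat \<Rightarrow> (nat \<Rightarrow> real) \<Rightarrow> bool list \<Rightarrow> real" where
  "linear_stat n h t = (\<Sum>j<n. h j * of_bool (nth_default False t j))"

text \<open>Exchanging the sums shows that the sample average of the statistic is a function of the
  empirical means, as a mean-based algorithm requires.\<close>

lemma linear_stat_empirical_means:
  "(\<Sum>j<n. h j * empirical_means n ts ! j) = (\<Sum>t\<leftarrow>ts. linear_stat n h t) / real (length ts)"
proof -
  have "(\<Sum>j<n. h j * (\<Sum>t\<leftarrow>ts. of_bool (nth_default False t j))) =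
      (\<Sum>t\<leftarrow>ts. linear_stat n h t)"
    unfolding linear_stat_def by (induction ts) (simp_all add: sum.distrib distrib_left del: sum_mult_of_bool_eq)
  then show ?thesis
    unfolding empirical_means_def by (simp add: sum_divide_distrib[symmetric])
qed

lemma abs_linear_stat_le:
  assumes "\<And>j. j < n \<Longrightarrow> \<bar>h j\<bar> \<le> real n"
  shows "\<bar>linear_stat n h t\<bar> \<le> (real n)\<^sup>2"
proof -
  have "\<bar>linear_stat n h t\<bar> \<le> (\<Sum>j<n. \<bar>h j * of_bool (nth_default False t j)\<bar>)"
    unfolding linear_stat_def by (rule sum_abs)
  also have "\<dots> \<le> (\<Sum>j<n. real n)"
    using assms by (intro sum_mono) auto
  finally show ?thesis by (simp add: power2_eq_square)
qed

text \<open>The algorithm picks the string with the nearer expectation, so it errs only if the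
  estimate is off by at least \<open>\<delta> / 2\<close>. Chebyshev bounds this by
  \<open>4 * B\<^sup>2 / (T * \<delta>\<^sup>2)\<close>, and the factor 12 brings it down to
  1/3.\<close>

lemma distinguishes_whp_linear_stat:
  fixes h :: "nat \<Rightarrow> real"
  assumes "0 < T" "0 < \<delta>" "x \<noteq> y"
    and bound: "\<And>t. \<bar>linear_stat n h t\<bar> \<le> B"
    and sep: "\<delta> \<le> \<bar>measure_pmf.expectation (trace_pmf p x) (linear_stat n h) -
      measure_pmf.expectation (trace_pmf p y) (linear_stat n h)\<bar>"
    and T: "12 * B\<^sup>2 \<le> real T * \<delta>\<^sup>2"
  shows "\<exists>A. distinguishes_whp p n T x y A"
proof -
  define \<mu> where "\<mu> s = measure_pmf.expectation (trace_pmf p s) (linear_stat n h)" for s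
  define stat where "stat m = (\<Sum>j<n. h j * m ! j)" for m :: "real list"
  define A where "A m = (if \<bar>stat m - \<mu> x\<bar> < \<bar>stat m - \<mu> y\<bar> then x else y)" for m
  have A_eq: "A m = s" if "s \<in> {x, y}" "\<bar>stat m - \<mu> s\<bar> < \<delta> / 2" for m s
  proof -
    have "\<delta> \<le> \<bar>stat m - \<mu> x\<bar> + \<bar>stat m - \<mu> y\<bar>"
      using sep unfolding \<mu>_def[symmetric] by linarith
    then show ?thesis using that \<open>x \<noteq> y\<close> by (auto simp: A_def)
  qed
  have "2 / 3 \<le> measure_pmf.prob (replicate_pmf T (trace_pmf p s))
      {ts. A (empirical_means n ts) = s}" if s: "s \<in> {x, y}" for s
  proof -
    let ?R = "replicate_pmf T (trace_pmf p s)"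
    let ?bad = "{ts. \<delta> / 2 \<le> \<bar>stat (empirical_means n ts) - \<mu> s\<bar>}"
    have "measure_pmf.prob ?R ?bad \<le> B\<^sup>2 / (real T * (\<delta> / 2)\<^sup>2)"
      unfolding stat_def linear_stat_empirical_means \<mu>_def
      using assms(1,2) bound by (intro Chebyshev_replicate_pmf finite_set_trace_pmf) auto
    also have "\<dots> \<le> 1 / 3"
      using T assms(1,2) by (simp add: field_simps power2_eq_square)
    finally have bad: "measure_pmf.prob ?R ?bad \<le> 1 / 3" .
    have "1 - measure_pmf.prob ?R ?bad = measure_pmf.prob ?R (- ?bad)"
      by (subst measure_pmf.prob_compl[symmetric]) (auto simp: Compl_eq_Diff_UNIV)
    also have "\<dots> \<le> measure_pmf.prob ?R {ts. A (empirical_means n ts) = s}"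
      using A_eq[OF s] by (intro measure_pmf.finite_measure_mono) auto
    finally show ?thesis using bad by simp
  qed
  moreover have "range A \<subseteq> {x, y}" by (auto simp: A_def)
  ultimately show ?thesis unfolding distinguishes_whp_def by blast
qed

lemma expectation_linear_stat_trace:
  assumes "0 \<le> p" "p \<le> 1" "length x = n"
  shows "measure_pmf.expectation (trace_pmf p x) (linear_stat n (\<lambda>_. 1)) = (1 - p) * real (ones x)"
    and "measure_pmf.expectation (trace_pmf p x) (linear_stat n real) =
      (1 - p)\<^sup>2 * real (ones_pos_sum x)"
proof -
  have "measure_pmf.expectation (trace_pmf p x) (linear_stat n (\<lambda>_. 1)) =
      measure_pmf.expectation (trace_pmf p x) (\<lambda>t. real (ones t))"
    using assms(3) length_trace_le[of _ p x] ones_eq_sum[of _ n]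
    by (intro integral_cong_AE) (auto simp: AE_measure_pmf_iff linear_stat_def simp del: sum_of_bool_eq)
  then show "measure_pmf.expectation (trace_pmf p x) (linear_stat n (\<lambda>_. 1)) =
      (1 - p) * real (ones x)"
    using assms by (simp add: expectation_ones_trace)
  have "measure_pmf.expectation (trace_pmf p x) (linear_stat n real) =
      measure_pmf.expectation (trace_pmf p x) (\<lambda>t. real (ones_pos_sum t))"
    using assms(3) length_trace_le[of _ p x] ones_pos_sum_eq_sum[of _ n]
    by (intro integral_cong_AE)
      (auto simp: AE_measure_pmf_iff linear_stat_def simp del: sum_mult_of_bool_eq)
  then show "measure_pmf.expectation (trace_pmf p x) (linear_stat n real) =
      (1 - p)\<^sup>2 * real (ones_pos_sum x)"
    using assms by (simp add: expectation_ones_pos_sum_trace)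
qed

text \<open>Differing moments are natural numbers, hence at least 1 apart. The gap is
  \<open>1 - p\<close> or \<open>(1 - p)\<^sup>2\<close> times that, and the smaller factor serves
  both cases.\<close>

lemma edit_dist_2_linear_stat_separates:
  assumes "0 \<le> p" "p \<le> 1" "length x = n" "length y = n" "x \<noteq> y" "edit_dist x y = 2"
  obtains h :: "nat \<Rightarrow> real" where "\<And>j. j < n \<Longrightarrow> \<bar>h j\<bar> \<le> real n"
    and "(1 - p)\<^sup>2 \<le> \<bar>measure_pmf.expectation (trace_pmf p x) (linear_stat n h) -
      measure_pmf.expectation (trace_pmf p y) (linear_stat n h)\<bar>"
proof -
  have scaled: "q \<le> \<bar>q * real a - q * real b\<bar>" if "a \<noteq> b" "0 \<le> q" for q :: real and a b :: nat
  proof -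
    have "1 \<le> \<bar>real a - real b\<bar>" using that(1) by linarith
    then have "q * 1 \<le> q * \<bar>real a - real b\<bar>" using that(2) by (rule mult_left_mono)
    then show ?thesis using that(2) by (simp add: abs_mult flip: right_diff_distrib)
  qed
  consider "ones x \<noteq> ones y" | "ones_pos_sum x \<noteq> ones_pos_sum y"
    using edit_dist_2_moments_differ assms by metis
  then show thesis
  proof cases
    case 1
    have "(1 - p)\<^sup>2 \<le> 1 - p"
      using assms(1,2) mult_left_le[of "1 - p" "1 - p"] by (simp add: power2_eq_square)
    also have "\<dots> \<le> \<bar>(1 - p) * real (ones x) - (1 - p) * real (ones y)\<bar>"
      using scaled[OF 1, of "1 - p"] assms(2) by simp
    finally show thesis
      using that[of "\<lambda>_. 1"] assms by (simp add: expectation_linear_stat_trace)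
  next
    case 2
    then show thesis
      using that[of real] scaled[OF 2, of "(1 - p)\<^sup>2"] assms
      by (simp add: expectation_linear_stat_trace)
  qed
qed

theorem corollary1:
  fixes p :: real
  assumes "0 < p" and "p < 1"
  shows "\<exists>C::real. C > 0 \<and>
    (\<forall>n::nat. n \<ge> 2 \<longrightarrow>
      (\<forall>x y :: bool list.
        length x = n \<longrightarrow> length y = n \<longrightarrow> x \<noteq> y \<longrightarrow> edit_dist x y = 2 \<longrightarrow>
        (\<exists>(T::nat) A. real T \<le> real n powr C \<and> distinguishes_whp p n T x y A)))"
proof -
  define \<delta> where "\<delta> = (1 - p)\<^sup>2"
  \<comment> \<open>\<open>K\<close> depends on \<open>p\<close> alone; with
    \<open>B = n\<^sup>2\<close> and \<open>T = K * n ^ 4\<close> the trace bound of the test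
    reduces to \<open>12 \<le> K * \<delta>\<^sup>2\<close>.\<close>
  define K where "K = nat \<lceil>12 / \<delta>\<^sup>2\<rceil>"
  have \<delta>: "0 < \<delta>" using assms by (simp add: \<delta>_def)
  have K: "12 \<le> real K * \<delta>\<^sup>2"
  proof -
    have "12 / \<delta>\<^sup>2 \<le> real K" unfolding K_def by linarith
    then show ?thesis using \<delta> by (simp add: field_simps)
  qed
  then have "0 < K" by (intro gr0I) simp
  show ?thesis
  proof (intro exI[of _ "real (K + 4)"] conjI allI impI)
    fix n :: nat and x y :: "bool list"
    assume n: "2 \<le> n" and xy: "length x = n" "length y = n" "x \<noteq> y" "edit_dist x y = 2"
    obtain h :: "nat \<Rightarrow> real" where h: "\<And>j. j < n \<Longrightarrow> \<bar>h j\<bar> \<le> real n"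
      and sep: "\<delta> \<le> \<bar>measure_pmf.expectation (trace_pmf p x) (linear_stat n h) -
        measure_pmf.expectation (trace_pmf p y) (linear_stat n h)\<bar>"
      using edit_dist_2_linear_stat_separates[of p x n y] xy assms unfolding \<delta>_def by auto
    define T where "T = K * n ^ 4"
    have "12 * ((real n)\<^sup>2)\<^sup>2 \<le> real K * \<delta>\<^sup>2 * real n ^ 4"
      using K by (simp add: power_mult[symmetric] mult_right_mono)
    then have "12 * ((real n)\<^sup>2)\<^sup>2 \<le> real T * \<delta>\<^sup>2"
      by (simp add: T_def mult_ac)
    then have "\<exists>A. distinguishes_whp p n T x y A"
      using n \<open>0 < K\<close> \<delta> xy(3) sep abs_linear_stat_le[OF h]
      by (intro distinguishes_whp_linear_stat[where \<delta> = \<delta> and h = h and B = "(real n)\<^sup>2"])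
        (auto simp: T_def)
    moreover have "real T \<le> real n powr real (K + 4)"
    proof -
      \<comment> \<open>The constant factor is absorbed into the exponent by
        \<open>K < 2 ^ K\<close>, which is where \<open>n \<ge> 2\<close> matters.\<close>
      have "K \<le> n ^ K"
        using less_exp[of K] power_mono[OF n, of K] by linarith
      then have "T \<le> n ^ (K + 4)"
        unfolding T_def by (simp add: power_add)
      then have "real T \<le> real n ^ (K + 4)"
        by (metis of_nat_le_iff of_nat_power)
      then show ?thesis using n by (subst powr_realpow) auto
    qed
    ultimately show "\<exists>T A. real T \<le> real n powr real (K + 4) \<and> distinguishes_whp p n T x y A"
      by blast
  qed simp
qed

end
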